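(* For each integer $n\ge 2$ write $N=n-1$, and let $p_n$, $\varphi$, $\Phi$ be as in the context. For $x\ge0$ put $F_n(x)=\int_{-x}^{x}p_n(y)\,dy$. Then for every fixed $x\ge0$, as $n\to\infty$, $$N\left[F_n(x)-\bigl(2\Phi(x)-1\bigr)\right]\longrightarrow H(x):=\frac{x^3+3x}{2}\,\varphi(x).$$
   Context: $\varphi(y)=(2\pi)^{-1/2}e^{-y^2/2}$ and $\Phi(x)=\int_{-\infty}^x\varphi(y)\,dy$. For $n\ge2$ and $N=n-1$, let $$h_N(y)=\begin{cases}\left(1-\frac{y^2}{N}\right)^{N/2}, & |y|\le\sqrt N,\\ 0,& |y|>\sqrt N,\end{cases}\qquad D_N=\int_{\mathbb{R}}h_N(y)\,dy,\qquad p_n(y)=\frac{h_N(y)}{D_N}.$$ (Equivalently, $F_n(x)=\nu_n((-\tau_nx,\tau_nx))$ where $\nu_n$ is the probability measure on $[-\pi/2,\pi/2]$ with density proportional to $(1-4\theta^2/\pi^2)^{N/2}$ and $\tau_n=\pi/(2\sqrt N)$.) *)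

theory Defs
  imports "HOL-Probability.Distributions"
begin

text \<open>The density \<open>\<phi>\<close> of the paper is the library's \<^const>\<open>std_normal_density\<close>.
  All integrals are Lebesgue integrals.\<close>

definition Phi :: "real \<Rightarrow> real" where
  "Phi x = (LBINT y:{..x}. std_normal_density y)"

definition h :: "nat \<Rightarrow> real \<Rightarrow> real" where
  "h N y = (if \<bar>y\<bar> \<le> sqrt (real N) then (1 - y\<^sup>2 / real N) powr (real N / 2) else 0)"

definition D :: "nat \<Rightarrow> real" where
  "D N = (LBINT y. h N y)"

text \<open>\<open>p\<close> and \<open>F\<close> are indexed by \<open>n\<close>, while \<open>h\<close> and \<open>D\<close> are indexed by \<open>N = n - 1\<close>;
  they are meant for \<open>n \<ge> 2\<close> only.\<close>

definition p :: "nat \<Rightarrow> real \<Rightarrow> real" where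
  "p n y = h (n - 1) y / D (n - 1)"

definition F :: "nat \<Rightarrow> real \<Rightarrow> real" where
  "F n x = (LBINT y:{-x..x}. p n y)"

definition H :: "real \<Rightarrow> real" where
  "H x = (x ^ 3 + 3 * x) / 2 * std_normal_density x"

end

theory Submission
  imports Defs "HOL-Real_Asymp.Real_Asymp"
begin

text \<open>
  Since \<open>ln (1 - t) = - t - t\<^sup>2/2 - \<dots>\<close>, the rescaled error
  \<open>N (h\<^sub>N(y) / sqrt (2\<pi>) - \<phi>(y))\<close> tends to \<open>- y\<^sup>4 \<phi>(y) / 4\<close>, and it is dominated by
  \<open>y\<^sup>4 \<phi>(y)\<close>. Hence both the numerator and the normalising constant of \<open>F\<^sub>n(x)\<close> have
  first-order expansions in \<open>1/N\<close>, whose coefficients are truncated fourth moments of the normal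
  law. Integration by parts reduces the fourth moment over \<open>[-x, x]\<close> to \<open>2\<Phi>(x) - 1\<close>, and in the
  quotient the multiples of \<open>2\<Phi>(x) - 1\<close> cancel.
\<close>

section \<open>Pointwise comparison of \<open>h\<close> with the Gaussian\<close>

lemma h_nonneg: "0 \<le> h N y"
  by (simp add: h_def)

lemma borel_measurable_h [measurable]: "h N \<in> borel_measurable borel"
  unfolding h_def[abs_def] by measurable

lemma abs_le_sqrt_iff: "\<bar>y\<bar> \<le> sqrt a \<longleftrightarrow> y\<^sup>2 \<le> a" for a y :: real
  by (metis real_sqrt_abs real_sqrt_le_iff)

text \<open>With \<open>t\<close> = y^2/N, raise \<open>1 - t \<le> exp (- t)\<close> to the power
  N/2. This fixes the sign of the error.\<close>

lemma h_le_exp: "h N y \<le> exp (- y\<^sup>2 / 2)"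
proof (cases "\<bar>y\<bar> \<le> sqrt (real N) \<and> N > 0")
  case True
  define t where "t = y\<^sup>2 / real N"
  have t: "t \<le> 1"
    using True by (auto simp: t_def abs_le_sqrt_iff)
  have "h N y = (1 - t) powr (real N / 2)"
    using True by (simp add: h_def t_def)
  also have "\<dots> \<le> exp (- t) powr (real N / 2)"
    using t exp_ge_add_one_self[of "- t"] by (intro powr_mono2) auto
  also have "\<dots> = exp (- y\<^sup>2 / 2)"
    using True by (simp add: powr_def t_def)
  finally show ?thesis .
qed (auto simp: h_def)

text \<open>On the support, \<open>(1 + t) * exp (- t) \<le> 1\<close> gives
  \<open>(1 - t^2) * exp (- t) \<le> 1 - t\<close>. Its power N/2, combined with Bernoulli, yields h
  \<ge> (1 - N t^2) exp(-y^2/2), and N * N t^2 = y^4.\<close>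

lemma exp_minus_h_le:
  assumes "N > 0"
  shows "real N * (exp (- y\<^sup>2 / 2) - h N y) \<le> y ^ 4 * exp (- y\<^sup>2 / 2)"
proof (cases "\<bar>y\<bar> \<le> sqrt (real N)")
  case True
  define t where "t = y\<^sup>2 / real N"
  have t: "0 \<le> t" "t \<le> 1"
    using True assms by (auto simp: t_def abs_le_sqrt_iff)
  have t2: "t\<^sup>2 \<le> 1"
    using t by (simp add: power_le_one)
  have "(1 - t\<^sup>2) * exp (- t) \<le> 1 - t"
  proof -
    have "(1 + t) * exp (- t) \<le> 1"
      using exp_ge_add_one_self[of t] by (simp add: exp_minus field_simps)
    then have "(1 - t) * ((1 + t) * exp (- t)) \<le> (1 - t) * 1"
      using t by (intro mult_left_mono) auto
    then show ?thesis
      by (simp add: algebra_simps power2_eq_square)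
  qed
  \<comment> \<open>Bernoulli is applied with the natural exponent \<open>N\<close>, as N/2 may be
    fractional. Passing to N/2 only increases a power with base in [0, 1]; the factor 2 lost is
    harmless for a dominating function.\<close>
  have "1 - real N * t\<^sup>2 \<le> (1 - t\<^sup>2) ^ N"
    using Bernoulli_inequality[of "- t\<^sup>2" N] t2 by simp
  also have "\<dots> = (1 - t\<^sup>2) powr real N"
    using t2 assms by (simp add: powr_realpow')
  also have "\<dots> \<le> (1 - t\<^sup>2) powr (real N / 2)"
    using t2 by (intro powr_mono') auto
  finally have "(1 - real N * t\<^sup>2) * exp (- y\<^sup>2 / 2) \<le> (1 - t\<^sup>2) powr (real N / 2) * exp (- y\<^sup>2 / 2)"
    by (intro mult_right_mono) auto
  also have "\<dots> = ((1 - t\<^sup>2) * exp (- t)) powr (real N / 2)"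
    using t2 assms by (subst powr_mult) (auto simp: powr_def t_def)
  also have "\<dots> \<le> (1 - t) powr (real N / 2)"
    using \<open>(1 - t\<^sup>2) * exp (- t) \<le> 1 - t\<close> t2 by (intro powr_mono2) auto
  also have "\<dots> = h N y"
    using True by (simp add: h_def t_def)
  finally have "real N * (exp (- y\<^sup>2 / 2) - h N y) \<le> real N * (real N * t\<^sup>2 * exp (- y\<^sup>2 / 2))"
    by (intro mult_left_mono) (auto simp: algebra_simps)
  also have "\<dots> = y ^ 4 * exp (- y\<^sup>2 / 2)"
    using assms by (simp add: t_def field_simps power2_eq_square power4_eq_xxxx)
  finally show ?thesis .
next
  case False
  then have y: "real N \<le> y\<^sup>2" and "h N y = 0"
    by (auto simp: abs_le_sqrt_iff h_def)
  \<comment> \<open>Outside the support, 1 \<le> N \<le> y^2 and hence N \<le> y^4.\<close>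
  have "real N * 1 \<le> y\<^sup>2 * y\<^sup>2"
    using y assms by (intro mult_mono) auto
  then show ?thesis
    using \<open>h N y = 0\<close> by (simp add: power2_eq_square power4_eq_xxxx)
qed

lemma abs_h_error_le:
  assumes "N > 0"
  shows "\<bar>real N * (h N y / sqrt (2 * pi) - std_normal_density y)\<bar> \<le> std_normal_density y * y ^ 4"
proof -
  have "\<bar>real N * (h N y / sqrt (2 * pi) - std_normal_density y)\<bar>
      = real N * (exp (- y\<^sup>2 / 2) - h N y) / sqrt (2 * pi)"
    using h_le_exp[of N y]
    by (simp add: std_normal_density_def abs_mult flip: diff_divide_distrib)
  also have "\<dots> \<le> y ^ 4 * exp (- y\<^sup>2 / 2) / sqrt (2 * pi)"
    using exp_minus_h_le[OF assms] by (intro divide_right_mono) auto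
  finally show ?thesis
    by (simp add: std_normal_density_def mult.commute)
qed

text \<open>Here (N/2) ln(1 - a/N) = -a/2 - a^2/(4N) + O(1/N^2); exponentiating gives the
  coefficient of 1/N.\<close>

lemma one_minus_powr_expansion:
  fixes a :: real
  assumes "a > 0"
  shows "(\<lambda>N::nat. real N * ((1 - a / real N) powr (real N / 2) - exp (- a / 2)))
           \<longlonglongrightarrow> - (a\<^sup>2 / 4) * exp (- a / 2)"
proof -
  have "(\<lambda>N::nat. real N * ((1 - a / real N) powr (real N / 2) - exp (- a / 2)))
           \<longlonglongrightarrow> - (exp (- (a / 2)) * (a * a) / 4)"
    using assms by real_asymp
  then show ?thesis
    by (simp add: power2_eq_square mult.commute)
qed

lemma tendsto_h_error:
  "(\<lambda>N. real N * (h N y / sqrt (2 * pi) - std_normal_density y))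
     \<longlonglongrightarrow> - (std_normal_density y * y ^ 4 / 4)"
proof -
  have "(\<lambda>N::nat. real N * ((1 - y\<^sup>2 / real N) powr (real N / 2) - exp (- y\<^sup>2 / 2)))
           \<longlonglongrightarrow> - ((y\<^sup>2)\<^sup>2 / 4) * exp (- y\<^sup>2 / 2)"
  proof (cases "y = 0")
    case False
    then show ?thesis
      by (intro one_minus_powr_expansion) simp
  qed simp
  from tendsto_divide[OF this tendsto_const[of "sqrt (2 * pi)"]]
  have "(\<lambda>N::nat. real N * ((1 - y\<^sup>2 / real N) powr (real N / 2) / sqrt (2 * pi) - std_normal_density y))
           \<longlonglongrightarrow> - (std_normal_density y * y ^ 4 / 4)"
    by (simp add: std_normal_density_def mult.commute flip: diff_divide_distrib)
  \<comment> \<open>A fixed \<open>y\<close> lies in the support of \<open>h N\<close> as soon as N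
    \<ge> y^2.\<close>
  moreover have "eventually (\<lambda>N. h N y = (1 - y\<^sup>2 / real N) powr (real N / 2)) sequentially"
    using eventually_ge_at_top[of "nat \<lceil>y\<^sup>2\<rceil>"]
    by eventually_elim (auto simp: h_def abs_le_sqrt_iff)
  ultimately show ?thesis
    by (rule Lim_transform_eventually[OF _ eventually_mono]) auto
qed

section \<open>The integrated error\<close>

lemma integrable_std_normal_density_times_pow4:
  "integrable lborel (\<lambda>y. std_normal_density y * y ^ 4)"
  by (rule integrable_std_normal_moment)

lemma integrable_h:
  assumes "N > 0"
  shows "integrable lborel (h N)"
proof (rule Bochner_Integration.integrable_bound)
  show "integrable lborel (\<lambda>y. sqrt (2 * pi) * std_normal_density y)"
    by simp
  show "AE y in lborel. norm (h N y) \<le> norm (sqrt (2 * pi) * std_normal_density y)"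
    using h_le_exp[of N] h_nonneg[of N] by (auto simp: std_normal_density_def abs_mult)
qed simp

text \<open>Dominated convergence, for a general Borel set \<open>A\<close> so that both the
  numerator (\<open>A = {-x..x}\<close>) and the normalising constant (\<open>A = UNIV\<close>) are
  covered.\<close>

lemma tendsto_set_integral_h_error:
  assumes [measurable]: "A \<in> sets borel"
  shows "(\<lambda>N. real N * ((LBINT y:A. h N y) / sqrt (2 * pi) - (LBINT y:A. std_normal_density y)))
           \<longlonglongrightarrow> - (LBINT y:A. std_normal_density y * y ^ 4) / 4"
proof -
  define e where "e = (\<lambda>N y. real N * (h N y / sqrt (2 * pi) - std_normal_density y))"
  \<comment> \<open>The index \<open>Suc N\<close> makes the domination, which requires a positive
    index, hold for every term; \<open>LIMSEQ_imp_Suc\<close> undoes the shift.\<close>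
  have "(\<lambda>N. LBINT y. indicator A y * e (Suc N) y)
          \<longlonglongrightarrow> (LBINT y. indicator A y * - (std_normal_density y * y ^ 4 / 4))"
  proof (rule integral_dominated_convergence)
    show "integrable lborel (\<lambda>y. std_normal_density y * y ^ 4)"
      by (rule integrable_std_normal_density_times_pow4)
    show "AE y in lborel. (\<lambda>N. indicator A y * e (Suc N) y)
            \<longlonglongrightarrow> indicator A y * - (std_normal_density y * y ^ 4 / 4)"
      unfolding e_def by (intro AE_I2 tendsto_mult tendsto_const LIMSEQ_Suc tendsto_h_error)
    show "AE y in lborel. norm (indicator A y * e (Suc N) y) \<le> std_normal_density y * y ^ 4" for N
      using abs_h_error_le[of "Suc N"] unfolding e_def
      by (auto split: split_indicator)
  qed (auto simp: e_def)
  moreover have "(LBINT y. indicator A y * e (Suc N) y)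
     = real (Suc N) * ((LBINT y:A. h (Suc N) y) / sqrt (2 * pi) - (LBINT y:A. std_normal_density y))" for N
  proof -
    have "set_integrable lborel A (h (Suc N))" "set_integrable lborel A std_normal_density"
      unfolding set_integrable_def by (intro integrable_mult_indicator integrable_h; simp)+
    then have "(LBINT y:A. e (Suc N) y)
       = real (Suc N) * ((LBINT y:A. h (Suc N) y) / sqrt (2 * pi) - (LBINT y:A. std_normal_density y))"
      by (simp add: e_def set_integral_diff)
    then show ?thesis
      by (simp add: set_lebesgue_integral_def)
  qed
  moreover have "(LBINT y. indicator A y * - (std_normal_density y * y ^ 4 / 4))
     = - (LBINT y:A. std_normal_density y * y ^ 4) / 4"
    by (simp add: set_lebesgue_integral_def)
  ultimately show ?thesis
    by - (rule LIMSEQ_imp_Suc, simp)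
qed

section \<open>Truncated Gaussian integrals\<close>

lemma set_integrable_std_normal_density:
  assumes "A \<in> sets borel"
  shows "set_integrable lborel A std_normal_density"
  using assms unfolding set_integrable_def by (intro integrable_mult_indicator) auto

text \<open>By symmetry of the density the two tails have equal mass, and the total mass is 1. The
  closed pieces overlap in a single point, a null set.\<close>

lemma Phi_eq:
  assumes "x \<ge> 0"
  shows "2 * Phi x - 1 = (LBINT y:{-x..x}. std_normal_density y)"
proof -
  have AE_neq: "AE y in lborel. y \<noteq> c" for c :: real
    by (rule AE_lborel_singleton)
  have "{..x} = {..-x} \<union> {-x..x}"
    using assms by auto
  then have "Phi x = (LBINT y:{..-x} \<union> {-x..x}. std_normal_density y)"
    by (simp add: Phi_def)
  also have "\<dots> = (LBINT y:{..-x}. std_normal_density y) + (LBINT y:{-x..x}. std_normal_density y)"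
    using AE_neq[of "-x"]
    by (intro set_integral_Un_AE set_integrable_std_normal_density) auto
  also have "(LBINT y:{..-x}. std_normal_density y) = (LBINT y:{x..}. std_normal_density y)"
  proof -
    have "{y. - y \<in> {..-x}} = {x..}"
      by auto
    moreover have "std_normal_density (- y) = std_normal_density y" for y
      by (simp add: std_normal_density_def)
    ultimately show ?thesis
      by (subst set_integral_reflect) simp
  qed
  finally have 1: "Phi x = (LBINT y:{x..}. std_normal_density y) + (LBINT y:{-x..x}. std_normal_density y)" .
  have "1 = (LBINT y:{..x} \<union> {x..}. std_normal_density y)"
  proof -
    have "{..x} \<union> {x..} = UNIV"
      by auto
    then show ?thesis
      by (simp add: set_lebesgue_integral_def)
  qed
  also have "\<dots> = Phi x + (LBINT y:{x..}. std_normal_density y)"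
    using AE_neq[of x] unfolding Phi_def
    by (intro set_integral_Un_AE set_integrable_std_normal_density) auto
  finally show ?thesis
    using 1 by simp
qed

lemma set_integral_std_normal_density_pow4:
  assumes "x \<ge> 0"
  shows "(LBINT y:{-x..x}. std_normal_density y * y ^ 4)
    = 3 * (LBINT y:{-x..x}. std_normal_density y) - 2 * (x ^ 3 + 3 * x) * std_normal_density x"
proof -
  \<comment> \<open>Since the density satisfies \<phi>' = - y \<phi>, this \<open>G\<close> is an
    antiderivative of (y^4 - 3) \<phi>(y).\<close>
  define G where "G = (\<lambda>y. - (y ^ 3 + 3 * y) * std_normal_density y)"
  have "(LBINT y:{-x..x}. std_normal_density y * y ^ 4 - 3 * std_normal_density y) = G x - G (-x)"
    unfolding set_lebesgue_integral_def
  proof (rule integral_FTC_Icc)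
    show "-x \<le> x"
      using assms by simp
    show "(G has_vector_derivative std_normal_density y * y ^ 4 - 3 * std_normal_density y) (at y within {-x..x})" for y
    proof -
      have "(std_normal_density has_real_derivative - y * std_normal_density y) (at y within {-x..x})"
        unfolding std_normal_density_def[abs_def]
        by (rule DERIV_cong[OF DERIV_cmult[of "\<lambda>y. exp (- y\<^sup>2 / 2)" "- y * exp (- y\<^sup>2 / 2)"]])
          (auto intro!: derivative_eq_intros)
      then show ?thesis
        unfolding G_def has_real_derivative_iff_has_vector_derivative[symmetric]
        by (auto intro!: derivative_eq_intros
              simp: algebra_simps power2_eq_square power3_eq_cube power4_eq_xxxx)
    qed
    show "continuous_on {-x..x} (\<lambda>y. std_normal_density y * y ^ 4 - 3 * std_normal_density y)"
      unfolding std_normal_density_def by (intro continuous_intros) auto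
  qed
  moreover have "set_integrable lborel {-x..x} (\<lambda>y. std_normal_density y * y ^ 4)"
    unfolding set_integrable_def
    by (intro integrable_mult_indicator integrable_std_normal_density_times_pow4) auto
  moreover have "G x - G (-x) = - 2 * (x ^ 3 + 3 * x) * std_normal_density x"
  proof -
    have "std_normal_density (- x) = std_normal_density x"
      by (simp add: std_normal_density_def)
    then show ?thesis
      by (simp add: G_def algebra_simps)
  qed
  ultimately show ?thesis
    using set_integrable_std_normal_density[of "{-x..x}"]
    by (simp add: set_integral_diff algebra_simps)
qed

section \<open>Expansion of the quotient\<close>

lemma F_Suc: "F (Suc N) x = (LBINT y:{-x..x}. h N y) / D N"
  by (simp add: F_def p_def)

theorem theorem5p10:
  fixes x :: real
  assumes "x \<ge> 0"
  shows "(\<lambda>n::nat. real (n - 1) * (F n x - (2 * Phi x - 1))) \<longlonglongrightarrow> H x"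
proof -
  define I where "I = (LBINT y:{-x..x}. std_normal_density y)"
  \<comment> \<open>The common factor \<open>sqrt (2 * pi)\<close> cancels in
    \<open>a N / d N\<close> and makes the limits of \<open>a\<close> and \<open>d\<close> equal to
    \<open>I\<close> and 1.\<close>
  define a where "a = (\<lambda>N. (LBINT y:{-x..x}. h N y) / sqrt (2 * pi))"
  define d where "d = (\<lambda>N. D N / sqrt (2 * pi))"
  have a: "(\<lambda>N. real N * (a N - I)) \<longlonglongrightarrow> - (3 * I - 2 * (x ^ 3 + 3 * x) * std_normal_density x) / 4"
    using tendsto_set_integral_h_error[of "{-x..x}"] assms
    by (simp add: a_def I_def set_integral_std_normal_density_pow4)
  \<comment> \<open>The full fourth moment is 4!/(2^2 * 2!) = 3.\<close>
  have "(LBINT y. std_normal_density y * y ^ 4) = 3"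
    using integral_std_normal_moment_even[of 2] by (simp add: fact_numeral)
  then have d: "(\<lambda>N. real N * (d N - 1)) \<longlonglongrightarrow> - 3 / 4"
    using tendsto_set_integral_h_error[of UNIV]
    by (simp add: d_def D_def set_lebesgue_integral_def)
  have "(\<lambda>N. real N * (d N - 1) * inverse (real N)) \<longlonglongrightarrow> - 3 / 4 * 0"
    by (intro tendsto_mult d lim_inverse_n)
  then have "(\<lambda>N. real N * (d N - 1) * inverse (real N)) \<longlonglongrightarrow> 0"
    by simp
  then have "(\<lambda>N. d N - 1) \<longlonglongrightarrow> 0"
    by (rule Lim_transform_eventually)
      (use eventually_gt_at_top[of 0] in eventually_elim, simp)
  then have d1: "d \<longlonglongrightarrow> 1"
    by (simp add: LIM_zero_iff)
  \<comment> \<open>This rests on N (a/d - I) = (N (a - I) - I N (d - 1)) / d. In the limit the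
    terms 3I/4 cancel, leaving \<open>H x\<close>.\<close>
  have "(\<lambda>N. (real N * (a N - I) - I * (real N * (d N - 1))) / d N)
     \<longlonglongrightarrow> (- (3 * I - 2 * (x ^ 3 + 3 * x) * std_normal_density x) / 4 - I * (- 3 / 4)) / 1"
    by (intro tendsto_intros a d d1) auto
  also have "(- (3 * I - 2 * (x ^ 3 + 3 * x) * std_normal_density x) / 4 - I * (- 3 / 4)) / 1 = H x"
    by (simp add: H_def field_simps)
  finally have "(\<lambda>N. (real N * (a N - I) - I * (real N * (d N - 1))) / d N) \<longlonglongrightarrow> H x" .
  moreover have "eventually (\<lambda>N. (real N * (a N - I) - I * (real N * (d N - 1))) / d N
      = real N * (F (Suc N) x - I)) sequentially"
    \<comment> \<open>As \<open>d\<close> tends to 1, it is eventually positive, so division by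
      \<open>d N\<close> is legitimate.\<close>
    using order_tendstoD(1)[OF d1 zero_less_one]
  proof eventually_elim
    case (elim N)
    have "F (Suc N) x = a N / d N"
      by (simp add: F_Suc a_def d_def)
    then show ?case
      using elim by (simp add: field_simps)
  qed
  ultimately have "(\<lambda>N. real N * (F (Suc N) x - I)) \<longlonglongrightarrow> H x"
    by (rule Lim_transform_eventually)
  then show ?thesis
    by - (rule LIMSEQ_imp_Suc, simp add: Phi_eq[OF assms] I_def)
qed

end
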